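(* Let $(I,\preceq)$ be a finite poset and $(\sigma,\iota,\pi)$ an $(I,\preceq)$-configuration in an abelian category $\mathcal A$. Define $X=\sigma(I)$, and let $S^J\subset X$ be the subobject represented by $\iota(J,I):\sigma(J)\to X$ for each s-set $J\subseteq I$. Then $$S^\emptyset=0,\quad S^I=X,\quad S^A\cap S^B=S^{A\cap B}\quad\text{and}\quad S^A+S^B=S^{A\cup B}$$ for all s-sets $A,B\subseteq I$.
   Context: Let $(I,\preceq)$ be a finite poset. A subset $J\subseteq I$ is an s-set if $i\in I$, $j\in J$, $i\preceq j$ imply $i\in J$; it is an f-set if $i\in I$, $h,j\in J$, $h\preceq i\preceq j$ imply $i\in J$. $\mathcal F_{(I,\preceq)}$ is the set of f-sets of $I$; $\mathcal G_{(I,\preceq)}$ is the set of pairs $(J,K)$ of f-sets with $J\subseteq K$ such that $j\in J$, $k\in K$, $k\preceq j$ imply $k\in J$; $\mathcal H_{(I,\preceq)}$ is the set of pairs $(J,K)$ of f-sets with $K\subseteq J$ such that $j\in J$, $k\in K$, $k\preceq j$ imply $j\in K$. An $(I,\preceq)$-configuration $(\sigma,\iota,\pi)$ in $\mathcal A$ consists of objects $\sigma(J)$ for $J\in\mathcal F_{(I,\preceq)}$ with $\sigma(\emptyset)=0$; injective morphisms $\iota(J,K):\sigma(J)\to\sigma(K)$ for $(J,K)\in\mathcal G_{(I,\preceq)}$ with $\iota(J,J)=\mathrm{id}_{\sigma(J)}$; and surjective morphisms $\pi(J,K):\sigma(J)\to\sigma(K)$ for $(J,K)\in\mathcal H_{(I,\preceq)}$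 with $\pi(J,J)=\mathrm{id}_{\sigma(J)}$, such that: (A) if $(J,K)\in\mathcal G_{(I,\preceq)}$ and $L=K\setminus J$ then $0\to\sigma(J)\xrightarrow{\iota(J,K)}\sigma(K)\xrightarrow{\pi(K,L)}\sigma(L)\to0$ is exact; (B) if $(J,K),(K,L)\in\mathcal G_{(I,\preceq)}$ then $\iota(J,L)=\iota(K,L)\circ\iota(J,K)$; (C) if $(J,K),(K,L)\in\mathcal H_{(I,\preceq)}$ then $\pi(J,L)=\pi(K,L)\circ\pi(J,K)$; (D) if $(J,K)\in\mathcal G_{(I,\preceq)}$ and $(K,L)\in\mathcal H_{(I,\preceq)}$ then $\pi(K,L)\circ\iota(J,K)=\iota(J\cap L,L)\circ\pi(J,J\cap L)$. Subobjects of $X$ are equivalence classes of injective morphisms into $X$; $\cap$ and $+$ are the usual intersection and sum (join) of subobjects. *)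

theory Defs
  imports "HOL-Algebra.Group"
begin

section \<open>Categories\<close>

record ('o, 'm) category_data =
  Obj :: "'o set"
  Arr :: "'m set"
  Dom :: "'m \<Rightarrow> 'o"
  Cod :: "'m \<Rightarrow> 'o"
  Ident :: "'o \<Rightarrow> 'm"
  Comp :: "'m \<Rightarrow> 'm \<Rightarrow> 'm"  (infixr "\<cdot>\<index>" 75)

definition homset :: "('o, 'm, 'z) category_data_scheme \<Rightarrow> 'o \<Rightarrow> 'o \<Rightarrow> 'm set" where
  "homset C X Y = {f \<in> Arr C. Dom C f = X \<and> Cod C f = Y}"

locale category =
  fixes C (structure)
  assumes Dom_Obj: "f \<in> Arr C \<Longrightarrow> Dom C f \<in> Obj C"
    and Cod_Obj: "f \<in> Arr C \<Longrightarrow> Cod C f \<in> Obj C"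
    and Ident_hom: "X \<in> Obj C \<Longrightarrow> Ident C X \<in> homset C X X"
    and Comp_hom: "\<lbrakk>f \<in> homset C X Y; g \<in> homset C Y Z\<rbrakk> \<Longrightarrow> g \<cdot> f \<in> homset C X Z"
    and Ident_right: "f \<in> homset C X Y \<Longrightarrow> f \<cdot> Ident C X = f"
    and Ident_left: "f \<in> homset C X Y \<Longrightarrow> Ident C Y \<cdot> f = f"
    and Comp_assoc: "\<lbrakk>f \<in> homset C W X; g \<in> homset C X Y; h \<in> homset C Y Z\<rbrakk>
      \<Longrightarrow> (h \<cdot> g) \<cdot> f = h \<cdot> (g \<cdot> f)"

text \<open>Injective and surjective morphisms are monomorphisms and epimorphisms, as usual in an
  abelian category.\<close>

definition injective :: "('o, 'm, 'z) category_data_scheme \<Rightarrow> 'm \<Rightarrow> bool" where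
  "injective C m \<longleftrightarrow> m \<in> Arr C \<and>
     (\<forall>W \<in> Obj C. \<forall>f \<in> homset C W (Dom C m). \<forall>g \<in> homset C W (Dom C m).
        m \<cdot>\<^bsub>C\<^esub> f = m \<cdot>\<^bsub>C\<^esub> g \<longrightarrow> f = g)"

definition surjective :: "('o, 'm, 'z) category_data_scheme \<Rightarrow> 'm \<Rightarrow> bool" where
  "surjective C e \<longleftrightarrow> e \<in> Arr C \<and>
     (\<forall>W \<in> Obj C. \<forall>f \<in> homset C (Cod C e) W. \<forall>g \<in> homset C (Cod C e) W.
        f \<cdot>\<^bsub>C\<^esub> e = g \<cdot>\<^bsub>C\<^esub> e \<longrightarrow> f = g)"

definition isomorphism :: "('o, 'm, 'z) category_data_scheme \<Rightarrow> 'm \<Rightarrow> bool" where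
  "isomorphism C f \<longleftrightarrow> f \<in> Arr C \<and>
     (\<exists>g \<in> homset C (Cod C f) (Dom C f).
        g \<cdot>\<^bsub>C\<^esub> f = Ident C (Dom C f) \<and> f \<cdot>\<^bsub>C\<^esub> g = Ident C (Cod C f))"

definition zero_object :: "('o, 'm, 'z) category_data_scheme \<Rightarrow> 'o \<Rightarrow> bool" where
  "zero_object C Z \<longleftrightarrow> Z \<in> Obj C \<and>
     (\<forall>X \<in> Obj C. (\<exists>!f. f \<in> homset C Z X) \<and> (\<exists>!f. f \<in> homset C X Z))"


section \<open>Subobjects\<close>

text \<open>Subobjects of \<open>X\<close> are equivalence classes of injective morphisms into \<open>X\<close>;
  \<open>subobj C m\<close> is the subobject represented by \<open>m\<close>.\<close>

definition subobj_rel :: "('o, 'm, 'z) category_data_scheme \<Rightarrow> 'o \<Rightarrow> 'm rel" where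
  "subobj_rel C X = {(m, n). injective C m \<and> Cod C m = X \<and> injective C n \<and> Cod C n = X \<and>
     (\<exists>h \<in> homset C (Dom C m) (Dom C n). isomorphism C h \<and> m = n \<cdot>\<^bsub>C\<^esub> h)}"

definition Subobj :: "('o, 'm, 'z) category_data_scheme \<Rightarrow> 'o \<Rightarrow> 'm set set" where
  "Subobj C X = {m. injective C m \<and> Cod C m = X} // subobj_rel C X"

definition subobj :: "('o, 'm, 'z) category_data_scheme \<Rightarrow> 'm \<Rightarrow> 'm set" where
  "subobj C m = subobj_rel C (Cod C m) `` {m}"

definition sub_le :: "('o, 'm, 'z) category_data_scheme \<Rightarrow> 'm set \<Rightarrow> 'm set \<Rightarrow> bool" where
  "sub_le C P Q \<longleftrightarrow> (\<exists>m \<in> P. \<exists>n \<in> Q. \<exists>a \<in> homset C (Dom C m) (Dom C n). m = n \<cdot>\<^bsub>C\<^esub> a)"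

definition is_sub_meet ::
    "('o, 'm, 'z) category_data_scheme \<Rightarrow> 'o \<Rightarrow> 'm set \<Rightarrow> 'm set \<Rightarrow> 'm set \<Rightarrow> bool" where
  "is_sub_meet C X P Q R \<longleftrightarrow> R \<in> Subobj C X \<and> sub_le C R P \<and> sub_le C R Q \<and>
     (\<forall>T \<in> Subobj C X. sub_le C T P \<and> sub_le C T Q \<longrightarrow> sub_le C T R)"

definition is_sub_join ::
    "('o, 'm, 'z) category_data_scheme \<Rightarrow> 'o \<Rightarrow> 'm set \<Rightarrow> 'm set \<Rightarrow> 'm set \<Rightarrow> bool" where
  "is_sub_join C X P Q R \<longleftrightarrow> R \<in> Subobj C X \<and> sub_le C P R \<and> sub_le C Q R \<and>
     (\<forall>T \<in> Subobj C X. sub_le C P T \<and> sub_le C Q T \<longrightarrow> sub_le C R T)"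

text \<open>In an abelian category the meet and the join of two subobjects exist uniquely; they are
  given by the familiar constructions with the biproduct, see the lemmas \<open>sub_inter_eq\<close> and
  \<open>sub_plus_eq\<close> at the end.\<close>

definition sub_inter ::
    "('o, 'm, 'z) category_data_scheme \<Rightarrow> 'o \<Rightarrow> 'm set \<Rightarrow> 'm set \<Rightarrow> 'm set" where
  "sub_inter C X P Q = (THE R. is_sub_meet C X P Q R)"

definition sub_plus ::
    "('o, 'm, 'z) category_data_scheme \<Rightarrow> 'o \<Rightarrow> 'm set \<Rightarrow> 'm set \<Rightarrow> 'm set" where
  "sub_plus C X P Q = (THE R. is_sub_join C X P Q R)"


section \<open>Abelian categories\<close>

record ('o, 'm) preadditive_data = "('o, 'm) category_data" +
  Add :: "'m \<Rightarrow> 'm \<Rightarrow> 'm"  (infixl "\<oplus>\<index>" 65)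
  Zero :: "'o \<Rightarrow> 'o \<Rightarrow> 'm"

definition hom_group :: "('o, 'm, 'z) preadditive_data_scheme \<Rightarrow> 'o \<Rightarrow> 'o \<Rightarrow> 'm monoid" where
  "hom_group C X Y = \<lparr>carrier = homset C X Y, mult = Add C, one = Zero C X Y\<rparr>"

locale preadditive_category = category +
  assumes hom_group: "\<lbrakk>X \<in> Obj C; Y \<in> Obj C\<rbrakk> \<Longrightarrow> comm_group (hom_group C X Y)"
    and Comp_Add_right: "\<lbrakk>f \<in> homset C X Y; g \<in> homset C X Y; h \<in> homset C Y Z\<rbrakk>
      \<Longrightarrow> h \<cdot> (f \<oplus> g) = (h \<cdot> f) \<oplus> (h \<cdot> g)"
    and Comp_Add_left: "\<lbrakk>f \<in> homset C X Y; g \<in> homset C Y Z; h \<in> homset C Y Z\<rbrakk>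
      \<Longrightarrow> (g \<oplus> h) \<cdot> f = (g \<cdot> f) \<oplus> (h \<cdot> f)"

definition is_biproduct ::
    "('o, 'm, 'z) preadditive_data_scheme \<Rightarrow> 'o \<Rightarrow> 'o \<Rightarrow> 'o \<Rightarrow> 'm \<Rightarrow> 'm \<Rightarrow> 'm \<Rightarrow> 'm \<Rightarrow> bool" where
  "is_biproduct C X Y U iX iY pX pY \<longleftrightarrow>
     iX \<in> homset C X U \<and> iY \<in> homset C Y U \<and> pX \<in> homset C U X \<and> pY \<in> homset C U Y \<and>
     pX \<cdot>\<^bsub>C\<^esub> iX = Ident C X \<and> pY \<cdot>\<^bsub>C\<^esub> iY = Ident C Y \<and>
     pX \<cdot>\<^bsub>C\<^esub> iY = Zero C Y X \<and> pY \<cdot>\<^bsub>C\<^esub> iX = Zero C X Y \<and>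
     (iX \<cdot>\<^bsub>C\<^esub> pX) \<oplus>\<^bsub>C\<^esub> (iY \<cdot>\<^bsub>C\<^esub> pY) = Ident C U"

definition is_kernel :: "('o, 'm, 'z) preadditive_data_scheme \<Rightarrow> 'm \<Rightarrow> 'm \<Rightarrow> bool" where
  "is_kernel C k f \<longleftrightarrow> f \<in> Arr C \<and> k \<in> homset C (Dom C k) (Dom C f) \<and>
     f \<cdot>\<^bsub>C\<^esub> k = Zero C (Dom C k) (Cod C f) \<and>
     (\<forall>W \<in> Obj C. \<forall>h \<in> homset C W (Dom C f). f \<cdot>\<^bsub>C\<^esub> h = Zero C W (Cod C f) \<longrightarrow>
        (\<exists>!u. u \<in> homset C W (Dom C k) \<and> k \<cdot>\<^bsub>C\<^esub> u = h))"

definition is_cokernel :: "('o, 'm, 'z) preadditive_data_scheme \<Rightarrow> 'm \<Rightarrow> 'm \<Rightarrow> bool" where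
  "is_cokernel C c f \<longleftrightarrow> f \<in> Arr C \<and> c \<in> homset C (Cod C f) (Cod C c) \<and>
     c \<cdot>\<^bsub>C\<^esub> f = Zero C (Dom C f) (Cod C c) \<and>
     (\<forall>W \<in> Obj C. \<forall>h \<in> homset C (Cod C f) W. h \<cdot>\<^bsub>C\<^esub> f = Zero C (Dom C f) W \<longrightarrow>
        (\<exists>!u. u \<in> homset C (Cod C c) W \<and> u \<cdot>\<^bsub>C\<^esub> c = h))"

locale abelian_category = preadditive_category +
  assumes ex_zero_object: "\<exists>Z. zero_object C Z"
    and ex_biproduct: "\<lbrakk>X \<in> Obj C; Y \<in> Obj C\<rbrakk> \<Longrightarrow> \<exists>U iX iY pX pY. is_biproduct C X Y U iX iY pX pY"
    and ex_kernel: "f \<in> Arr C \<Longrightarrow> \<exists>k. is_kernel C k f"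
    and ex_cokernel: "f \<in> Arr C \<Longrightarrow> \<exists>c. is_cokernel C c f"
    and injective_normal: "injective C m \<Longrightarrow> \<exists>f. is_kernel C m f"
    and surjective_conormal: "surjective C e \<Longrightarrow> \<exists>f. is_cokernel C e f"

definition is_image :: "('o, 'm, 'z) preadditive_data_scheme \<Rightarrow> 'm \<Rightarrow> 'm \<Rightarrow> bool" where
  "is_image C e f \<longleftrightarrow> (\<exists>c. is_cokernel C c f \<and> is_kernel C e c)"

definition exact_at :: "('o, 'm, 'z) preadditive_data_scheme \<Rightarrow> 'm \<Rightarrow> 'm \<Rightarrow> bool" where
  "exact_at C f g \<longleftrightarrow> Cod C f = Dom C g \<and> (\<exists>e. is_image C e f \<and> is_kernel C e g)"

definition short_exact :: "('o, 'm, 'z) preadditive_data_scheme \<Rightarrow> 'm \<Rightarrow> 'm \<Rightarrow> bool" where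
  "short_exact C f g \<longleftrightarrow> (\<exists>Z. zero_object C Z \<and>
     exact_at C (Zero C Z (Dom C f)) f \<and> exact_at C f g \<and> exact_at C g (Zero C (Cod C g) Z))"

text \<open>The class of \<open>0 \<rightarrow> X\<close> does not depend on the zero object chosen.\<close>

definition sub_zero :: "('o, 'm, 'z) preadditive_data_scheme \<Rightarrow> 'o \<Rightarrow> 'm set" where
  "sub_zero C X = subobj C (Zero C (SOME Z. zero_object C Z) X)"

definition sub_top :: "('o, 'm, 'z) category_data_scheme \<Rightarrow> 'o \<Rightarrow> 'm set" where
  "sub_top C X = subobj C (Ident C X)"


section \<open>Configurations\<close>

text \<open>A poset is given by a carrier \<open>I\<close> and a relation \<open>r\<close>, with \<open>(i, j) \<in> r\<close> for
  \<open>i \<preceq> j\<close>.\<close>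

definition s_set :: "'i set \<Rightarrow> 'i rel \<Rightarrow> 'i set \<Rightarrow> bool" where
  "s_set I r J \<longleftrightarrow> J \<subseteq> I \<and> (\<forall>i \<in> I. \<forall>j \<in> J. (i, j) \<in> r \<longrightarrow> i \<in> J)"

definition f_sets :: "'i set \<Rightarrow> 'i rel \<Rightarrow> 'i set set" where
  "f_sets I r = {J. J \<subseteq> I \<and>
     (\<forall>i \<in> I. \<forall>h \<in> J. \<forall>j \<in> J. (h, i) \<in> r \<and> (i, j) \<in> r \<longrightarrow> i \<in> J)}"

definition G_pairs :: "'i set \<Rightarrow> 'i rel \<Rightarrow> ('i set \<times> 'i set) set" where
  "G_pairs I r = {(J, K). J \<in> f_sets I r \<and> K \<in> f_sets I r \<and> J \<subseteq> K \<and>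
     (\<forall>j \<in> J. \<forall>k \<in> K. (k, j) \<in> r \<longrightarrow> k \<in> J)}"

definition H_pairs :: "'i set \<Rightarrow> 'i rel \<Rightarrow> ('i set \<times> 'i set) set" where
  "H_pairs I r = {(J, K). J \<in> f_sets I r \<and> K \<in> f_sets I r \<and> K \<subseteq> J \<and>
     (\<forall>j \<in> J. \<forall>k \<in> K. (k, j) \<in> r \<longrightarrow> j \<in> K)}"

text \<open>Since zero objects are only unique up to isomorphism, \<open>\<sigma>(\<emptyset>) = 0\<close> is
  read as: \<open>\<sigma>(\<emptyset>)\<close> is a zero object.\<close>

locale configuration =
  fixes C (structure)
    and I :: "'i set" and r :: "'i rel"
    and \<sigma> :: "'i set \<Rightarrow> 'o"
    and \<iota> :: "'i set \<Rightarrow> 'i set \<Rightarrow> 'm"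
    and \<pi> :: "'i set \<Rightarrow> 'i set \<Rightarrow> 'm"
  assumes sigma_Obj: "J \<in> f_sets I r \<Longrightarrow> \<sigma> J \<in> Obj C"
    and sigma_empty: "zero_object C (\<sigma> {})"
    and iota_hom: "(J, K) \<in> G_pairs I r \<Longrightarrow> \<iota> J K \<in> homset C (\<sigma> J) (\<sigma> K)"
    and iota_injective: "(J, K) \<in> G_pairs I r \<Longrightarrow> injective C (\<iota> J K)"
    and iota_refl: "J \<in> f_sets I r \<Longrightarrow> \<iota> J J = Ident C (\<sigma> J)"
    and pi_hom: "(J, K) \<in> H_pairs I r \<Longrightarrow> \<pi> J K \<in> homset C (\<sigma> J) (\<sigma> K)"
    and pi_surjective: "(J, K) \<in> H_pairs I r \<Longrightarrow> surjective C (\<pi> J K)"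
    and pi_refl: "J \<in> f_sets I r \<Longrightarrow> \<pi> J J = Ident C (\<sigma> J)"
    and config_A: "(J, K) \<in> G_pairs I r \<Longrightarrow> short_exact C (\<iota> J K) (\<pi> K (K - J))"
    and config_B: "\<lbrakk>(J, K) \<in> G_pairs I r; (K, L) \<in> G_pairs I r\<rbrakk> \<Longrightarrow> \<iota> J L = \<iota> K L \<cdot> \<iota> J K"
    and config_C: "\<lbrakk>(J, K) \<in> H_pairs I r; (K, L) \<in> H_pairs I r\<rbrakk> \<Longrightarrow> \<pi> J L = \<pi> K L \<cdot> \<pi> J K"
    and config_D: "\<lbrakk>(J, K) \<in> G_pairs I r; (K, L) \<in> H_pairs I r\<rbrakk>
      \<Longrightarrow> \<pi> K L \<cdot> \<iota> J K = \<iota> (J \<inter> L) L \<cdot> \<pi> J (J \<inter> L)"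


section \<open>Intersections and sums of subobjects are well defined\<close>

context category
begin

lemma homD: "f \<in> homset C X Y \<Longrightarrow> f \<in> Arr C \<and> Dom C f = X \<and> Cod C f = Y \<and> X \<in> Obj C \<and> Y \<in> Obj C"
  using Dom_Obj Cod_Obj by (auto simp: homset_def)

lemma homI: "f \<in> Arr C \<Longrightarrow> f \<in> homset C (Dom C f) (Cod C f)"
  by (simp add: homset_def)

lemma injectiveD:
  assumes "injective C m" "m \<in> homset C S X" "f \<in> homset C W S" "g \<in> homset C W S" "m \<cdot> f = m \<cdot> g"
  shows "f = g"
  using assms homD[OF assms(2)] homD[OF assms(3)] unfolding injective_def by blast

lemma injectiveI:
  assumes "m \<in> homset C S X"
    and "\<And>W f g. f \<in> homset C W S \<Longrightarrow> g \<in> homset C W S \<Longrightarrow> m \<cdot> f = m \<cdot> g \<Longrightarrow> f = g"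
  shows "injective C m"
  using assms homD[OF assms(1)] unfolding injective_def by blast

lemma injective_hom: "injective C m \<Longrightarrow> m \<in> homset C (Dom C m) (Cod C m)"
  by (simp add: injective_def homset_def)

lemma subobj_rel_iff:
  "(m, n) \<in> subobj_rel C X \<longleftrightarrow> injective C m \<and> Cod C m = X \<and> injective C n \<and> Cod C n = X \<and>
     (\<exists>a \<in> homset C (Dom C m) (Dom C n). m = n \<cdot> a) \<and>
     (\<exists>b \<in> homset C (Dom C n) (Dom C m). n = m \<cdot> b)"  (is "?L \<longleftrightarrow> ?R")
proof
  assume ?L
  then obtain h where m: "injective C m" "Cod C m = X" and n: "injective C n" "Cod C n = X"
    and h: "h \<in> homset C (Dom C m) (Dom C n)" "isomorphism C h" "m = n \<cdot> h"
    unfolding subobj_rel_def by auto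
  from h obtain g where g: "g \<in> homset C (Dom C n) (Dom C m)" "h \<cdot> g = Ident C (Dom C n)"
    using homD[OF h(1)] unfolding isomorphism_def by auto
  have "m \<cdot> g = n"
    using Comp_assoc[OF g(1) h(1) injective_hom[OF n(1)]] g(2) h(3)
      Ident_right[OF injective_hom[OF n(1)]] by simp
  then have "n = m \<cdot> g" by (rule sym)
  then show ?R using m n h(1,3) g(1) by blast
next
  assume ?R
  then obtain a b where m: "injective C m" "Cod C m = X" and n: "injective C n" "Cod C n = X"
    and a: "a \<in> homset C (Dom C m) (Dom C n)" "m = n \<cdot> a"
    and b: "b \<in> homset C (Dom C n) (Dom C m)" "n = m \<cdot> b" by blast
  note mh = injective_hom[OF m(1)] and nh = injective_hom[OF n(1)]
  have "m \<cdot> (b \<cdot> a) = m \<cdot> Ident C (Dom C m)"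
    using Comp_assoc[OF a(1) b(1) mh] by (simp only: a(2)[symmetric] b(2)[symmetric] Ident_right[OF mh])
  then have "b \<cdot> a = Ident C (Dom C m)"
    using injectiveD[OF m(1) mh Comp_hom[OF a(1) b(1)]] Ident_hom homD[OF mh] by blast
  moreover have "n \<cdot> (a \<cdot> b) = n \<cdot> Ident C (Dom C n)"
    using Comp_assoc[OF b(1) a(1) nh] by (simp only: a(2)[symmetric] b(2)[symmetric] Ident_right[OF nh])
  then have "a \<cdot> b = Ident C (Dom C n)"
    using injectiveD[OF n(1) nh Comp_hom[OF b(1) a(1)]] Ident_hom homD[OF nh] by blast
  ultimately have "isomorphism C a"
    using a(1) b(1) homD[OF a(1)] unfolding isomorphism_def by auto
  then show ?L using m n a unfolding subobj_rel_def by blast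
qed

lemma equiv_subobj_rel: "equiv {m. injective C m \<and> Cod C m = X} (subobj_rel C X)"
proof (rule equivI)
  show "subobj_rel C X \<subseteq> {m. injective C m \<and> Cod C m = X} \<times> {m. injective C m \<and> Cod C m = X}"
    by (auto simp: subobj_rel_def)
  show "refl_on {m. injective C m \<and> Cod C m = X} (subobj_rel C X)"
  proof (rule refl_onI)
    fix m assume "m \<in> {m. injective C m \<and> Cod C m = X}"
    then have m: "injective C m" "Cod C m = X" by auto
    note mh = injective_hom[OF m(1)]
    have "Ident C (Dom C m) \<in> homset C (Dom C m) (Dom C m)" and "m = m \<cdot> Ident C (Dom C m)"
      using Ident_hom homD[OF mh] Ident_right[OF mh] by auto
    then show "(m, m) \<in> subobj_rel C X"
      using m unfolding subobj_rel_iff by blast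
  qed
  show "sym (subobj_rel C X)" unfolding sym_def subobj_rel_iff by blast
  show "trans (subobj_rel C X)"
  proof (rule transI)
    fix l m n assume lm: "(l, m) \<in> subobj_rel C X" and mn: "(m, n) \<in> subobj_rel C X"
    from lm mn obtain a b a' b'
      where a: "a \<in> homset C (Dom C l) (Dom C m)" "l = m \<cdot> a"
        and b: "b \<in> homset C (Dom C m) (Dom C n)" "m = n \<cdot> b"
        and a': "a' \<in> homset C (Dom C m) (Dom C l)" "m = l \<cdot> a'"
        and b': "b' \<in> homset C (Dom C n) (Dom C m)" "n = m \<cdot> b'"
      unfolding subobj_rel_iff by blast
    have "l = n \<cdot> (b \<cdot> a)"
      using Comp_assoc[OF a(1) b(1) injective_hom] a(2) b(2) mn unfolding subobj_rel_iff by simp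
    moreover have "n = l \<cdot> (a' \<cdot> b')"
      using Comp_assoc[OF b'(1) a'(1) injective_hom] a'(2) b'(2) lm unfolding subobj_rel_iff by simp
    ultimately show "(l, n) \<in> subobj_rel C X"
      using lm mn Comp_hom[OF a(1) b(1)] Comp_hom[OF b'(1) a'(1)] unfolding subobj_rel_iff by blast
  qed
qed

lemma subobj_in_Subobj: "injective C m \<Longrightarrow> subobj C m \<in> Subobj C (Cod C m)"
  by (auto simp: Subobj_def subobj_def intro: quotientI)

lemma SubobjE:
  assumes "P \<in> Subobj C X"
  obtains m where "injective C m" "Cod C m = X" "P = subobj C m"
  using assms by (auto simp: Subobj_def subobj_def elim!: quotientE)

lemma mem_subobj:
  assumes "m' \<in> subobj C m"
  shows "(m, m') \<in> subobj_rel C (Cod C m)"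
  using assms by (simp add: subobj_def)

lemma subobj_self: "injective C m \<Longrightarrow> m \<in> subobj C m"
  using equiv_class_self[OF equiv_subobj_rel[of "Cod C m"], of m] by (simp add: subobj_def)

lemma sub_le_subobj:
  assumes "injective C m" "injective C n"
  shows "sub_le C (subobj C m) (subobj C n) \<longleftrightarrow> (\<exists>a \<in> homset C (Dom C m) (Dom C n). m = n \<cdot> a)"
    (is "?L \<longleftrightarrow> ?R")
proof
  assume ?L
  then obtain m' n' a where m': "m' \<in> subobj C m" and n': "n' \<in> subobj C n"
    and a: "a \<in> homset C (Dom C m') (Dom C n')" "m' = n' \<cdot> a"
    unfolding sub_le_def by blast
  obtain b where b: "b \<in> homset C (Dom C m) (Dom C m')" "m = m' \<cdot> b"
    using mem_subobj[OF m'] unfolding subobj_rel_iff by blast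
  obtain c where c: "c \<in> homset C (Dom C n') (Dom C n)" "n' = n \<cdot> c" and n'i: "injective C n'"
    using mem_subobj[OF n'] unfolding subobj_rel_iff by blast
  have "m = n \<cdot> (c \<cdot> (a \<cdot> b))"
    using Comp_assoc[OF b(1) a(1) injective_hom[OF n'i]]
      Comp_assoc[OF Comp_hom[OF b(1) a(1)] c(1) injective_hom[OF assms(2)]] a(2) b(2) c(2) by simp
  then show ?R using Comp_hom[OF Comp_hom[OF b(1) a(1)] c(1)] by blast
next
  assume ?R
  then show ?L using subobj_self assms unfolding sub_le_def by blast
qed

lemma sub_le_antisym:
  assumes "P \<in> Subobj C X" "Q \<in> Subobj C X" "sub_le C P Q" "sub_le C Q P"
  shows "P = Q"
proof -
  obtain m n where m: "injective C m" "Cod C m = X" "P = subobj C m"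
    and n: "injective C n" "Cod C n = X" "Q = subobj C n"
    using assms(1,2) by (auto elim!: SubobjE)
  have "(m, n) \<in> subobj_rel C X"
    using assms(3,4) m n sub_le_subobj unfolding subobj_rel_iff by auto
  then show ?thesis
    using equiv_class_eq[OF equiv_subobj_rel] m n by (simp add: subobj_def)
qed

lemma sub_inter_eqI: "is_sub_meet C X P Q R \<Longrightarrow> sub_inter C X P Q = R"
  unfolding sub_inter_def
  by (rule the_equality, assumption, rule sub_le_antisym) (auto simp: is_sub_meet_def)

lemma sub_plus_eqI: "is_sub_join C X P Q R \<Longrightarrow> sub_plus C X P Q = R"
  unfolding sub_plus_def
  by (rule the_equality, assumption, rule sub_le_antisym) (auto simp: is_sub_join_def)

end

context preadditive_category
begin

definition Neg :: "'b \<Rightarrow> 'b" where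
  "Neg f = inv\<^bsub>hom_group C (Dom C f) (Cod C f)\<^esub> f"

lemma
  assumes "X \<in> Obj C" "Y \<in> Obj C"
  shows Zero_hom: "Zero C X Y \<in> homset C X Y"
    and Add_hom: "\<lbrakk>f \<in> homset C X Y; g \<in> homset C X Y\<rbrakk> \<Longrightarrow> f \<oplus> g \<in> homset C X Y"
    and Neg_hom: "f \<in> homset C X Y \<Longrightarrow> Neg f \<in> homset C X Y"
    and Add_Neg: "f \<in> homset C X Y \<Longrightarrow> f \<oplus> Neg f = Zero C X Y"
    and Add_comm: "\<lbrakk>f \<in> homset C X Y; g \<in> homset C X Y\<rbrakk> \<Longrightarrow> f \<oplus> g = g \<oplus> f"
    and Add_Zero: "f \<in> homset C X Y \<Longrightarrow> f \<oplus> Zero C X Y = f"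
    and Zero_Add: "f \<in> homset C X Y \<Longrightarrow> Zero C X Y \<oplus> f = f"
    and Add_right_cancel: "\<lbrakk>f \<in> homset C X Y; g \<in> homset C X Y; h \<in> homset C X Y\<rbrakk>
      \<Longrightarrow> f \<oplus> h = g \<oplus> h \<longleftrightarrow> f = g"
    and Neg_unique: "\<lbrakk>f \<in> homset C X Y; g \<in> homset C X Y; f \<oplus> g = Zero C X Y\<rbrakk> \<Longrightarrow> f = Neg g"
proof -
  interpret G: comm_group "hom_group C X Y" by (rule hom_group[OF assms])
  have *: "carrier (hom_group C X Y) = homset C X Y" "mult (hom_group C X Y) = Add C"
    "one (hom_group C X Y) = Zero C X Y" by (simp_all add: hom_group_def)
  have N: "Neg f = inv\<^bsub>hom_group C X Y\<^esub> f" if "f \<in> homset C X Y" for f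
    using homD[OF that] by (simp add: Neg_def)
  show "Zero C X Y \<in> homset C X Y" using G.one_closed by (simp add: *)
  show "\<lbrakk>f \<in> homset C X Y; g \<in> homset C X Y\<rbrakk> \<Longrightarrow> f \<oplus> g \<in> homset C X Y"
    using G.m_closed by (simp add: *)
  show "f \<in> homset C X Y \<Longrightarrow> Neg f \<in> homset C X Y" using G.inv_closed N by (simp add: *)
  show "f \<in> homset C X Y \<Longrightarrow> f \<oplus> Neg f = Zero C X Y" using G.r_inv N by (simp add: *)
  show "\<lbrakk>f \<in> homset C X Y; g \<in> homset C X Y\<rbrakk> \<Longrightarrow> f \<oplus> g = g \<oplus> f"
    using G.m_comm by (simp add: *)
  show "f \<in> homset C X Y \<Longrightarrow> f \<oplus> Zero C X Y = f" using G.r_one by (simp add: *)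
  show "f \<in> homset C X Y \<Longrightarrow> Zero C X Y \<oplus> f = f" using G.l_one by (simp add: *)
  show "\<lbrakk>f \<in> homset C X Y; g \<in> homset C X Y; h \<in> homset C X Y\<rbrakk>
      \<Longrightarrow> f \<oplus> h = g \<oplus> h \<longleftrightarrow> f = g" using G.right_cancel by (simp add: *)
  show "\<lbrakk>f \<in> homset C X Y; g \<in> homset C X Y; f \<oplus> g = Zero C X Y\<rbrakk> \<Longrightarrow> f = Neg g"
    using G.inv_equality N by (simp add: *)
qed

lemma Comp_Zero:
  assumes "h \<in> homset C Y Z" "X \<in> Obj C"
  shows "h \<cdot> Zero C X Y = Zero C X Z"
proof -
  have o: "Y \<in> Obj C" "Z \<in> Obj C" using homD[OF assms(1)] by auto
  note z = Zero_hom[OF assms(2) o(1)]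
  note hz = Comp_hom[OF z assms(1)]
  have "(h \<cdot> Zero C X Y) \<oplus> (h \<cdot> Zero C X Y) = h \<cdot> Zero C X Y"
    using Comp_Add_right[OF z z assms(1)] Add_Zero[OF assms(2) o(1) z] by simp
  also have "\<dots> = Zero C X Z \<oplus> (h \<cdot> Zero C X Y)"
    using Zero_Add[OF assms(2) o(2) hz] by simp
  finally show ?thesis
    using Add_right_cancel[OF assms(2) o(2) hz Zero_hom[OF assms(2) o(2)] hz] by simp
qed

lemma Zero_Comp:
  assumes "h \<in> homset C X Y" "Z \<in> Obj C"
  shows "Zero C Y Z \<cdot> h = Zero C X Z"
proof -
  have o: "Y \<in> Obj C" "X \<in> Obj C" using homD[OF assms(1)] by auto
  note z = Zero_hom[OF o(1) assms(2)]
  note hz = Comp_hom[OF assms(1) z]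
  have "(Zero C Y Z \<cdot> h) \<oplus> (Zero C Y Z \<cdot> h) = Zero C Y Z \<cdot> h"
    using Comp_Add_left[OF assms(1) z z] Add_Zero[OF o(1) assms(2) z] by simp
  also have "\<dots> = Zero C X Z \<oplus> (Zero C Y Z \<cdot> h)"
    using Zero_Add[OF o(2) assms(2) hz] by simp
  finally show ?thesis
    using Add_right_cancel[OF o(2) assms(2) hz Zero_hom[OF o(2) assms(2)] hz] by simp
qed

lemma Comp_Neg:
  assumes "h \<in> homset C Y Z" "f \<in> homset C X Y"
  shows "h \<cdot> Neg f = Neg (h \<cdot> f)"
proof -
  have o: "X \<in> Obj C" "Y \<in> Obj C" "Z \<in> Obj C"
    using homD[OF assms(1)] homD[OF assms(2)] by auto
  note n = Neg_hom[OF o(1,2) assms(2)]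
  have "(h \<cdot> Neg f) \<oplus> (h \<cdot> f) = h \<cdot> (f \<oplus> Neg f)"
    using Comp_Add_right[OF n assms(2,1)] Add_comm[OF o(1,2) assms(2) n] by simp
  also have "\<dots> = Zero C X Z"
    using Add_Neg[OF o(1,2) assms(2)] Comp_Zero[OF assms(1) o(1)] by simp
  finally show ?thesis
    using Neg_unique[OF o(1,3) Comp_hom[OF n assms(1)] Comp_hom[OF assms(2,1)]] by simp
qed

lemma kernel_hom: "is_kernel C k f \<Longrightarrow> k \<in> homset C (Dom C k) (Dom C f)"
  by (simp add: is_kernel_def)

lemma kernel_factor:
  assumes "is_kernel C k f" "h \<in> homset C W (Dom C f)" "f \<cdot> h = Zero C W (Cod C f)"
  shows "\<exists>u \<in> homset C W (Dom C k). k \<cdot> u = h"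
  using assms homD[OF assms(2)] unfolding is_kernel_def by blast

lemma kernel_injective:
  assumes "is_kernel C k f"
  shows "injective C k"
proof (rule injectiveI[OF kernel_hom[OF assms]])
  fix W g h assume g: "g \<in> homset C W (Dom C k)" and h: "h \<in> homset C W (Dom C k)"
    and e: "k \<cdot> g = k \<cdot> h"
  have k: "k \<in> homset C (Dom C k) (Dom C f)" and f: "f \<in> homset C (Dom C f) (Cod C f)"
    and kz: "f \<cdot> k = Zero C (Dom C k) (Cod C f)"
    using assms homI by (auto simp: is_kernel_def)
  have "f \<cdot> (k \<cdot> h) = Zero C W (Cod C f)"
    using Comp_assoc[OF h k f] kz Zero_Comp[OF h] homD[OF f] by simp
  then have "\<exists>!u. u \<in> homset C W (Dom C k) \<and> k \<cdot> u = k \<cdot> h"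
    using assms Comp_hom[OF h k] homD[OF h] unfolding is_kernel_def by blast
  then show "g = h" using g h e by blast
qed

lemma sub_inter_eq:
  assumes m: "injective C m" "m \<in> homset C S X" and n: "injective C n" "n \<in> homset C T X"
    and U: "is_biproduct C S T U iS iT pS pT"
    and k: "is_kernel C k ((m \<cdot> pS) \<oplus> (n \<cdot> pT))"
  shows "injective C (m \<cdot> (pS \<cdot> k))"
    and "is_sub_meet C X (subobj C m) (subobj C n) (subobj C (m \<cdot> (pS \<cdot> k)))"
    and "sub_inter C X (subobj C m) (subobj C n) = subobj C (m \<cdot> (pS \<cdot> k))"
proof -
  define f where "f = (m \<cdot> pS) \<oplus> (n \<cdot> pT)"
  have h: "iS \<in> homset C S U" "iT \<in> homset C T U" "pS \<in> homset C U S" "pT \<in> homset C U T"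
    and e: "pS \<cdot> iS = Ident C S" "pT \<cdot> iT = Ident C T"
      "pS \<cdot> iT = Zero C T S" "pT \<cdot> iS = Zero C S T"
      "(iS \<cdot> pS) \<oplus> (iT \<cdot> pT) = Ident C U"
    using U by (simp_all add: is_biproduct_def)
  have o: "S \<in> Obj C" "T \<in> Obj C" "X \<in> Obj C" "U \<in> Obj C"
    using homD[OF m(2)] homD[OF n(2)] homD[OF h(1)] by simp_all
  note mp = Comp_hom[OF h(3) m(2)] and np = Comp_hom[OF h(4) n(2)]
  have f: "f \<in> homset C U X" unfolding f_def by (rule Add_hom[OF o(4,3) mp np])
  define K where "K = Dom C k"
  have kh: "k \<in> homset C K U" using kernel_hom[OF k] homD[OF f] by (simp add: K_def f_def)
  have oK: "K \<in> Obj C" using homD[OF kh] by simp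
  have fk: "f \<cdot> k = Zero C K X" using k homD[OF f] by (simp add: is_kernel_def f_def K_def)
  note sk = Comp_hom[OF kh h(3)] and tk = Comp_hom[OF kh h(4)]
  define s where "s = m \<cdot> (pS \<cdot> k)"
  define t where "t = n \<cdot> (pT \<cdot> k)"
  have sh: "s \<in> homset C K X" unfolding s_def by (rule Comp_hom[OF sk m(2)])
  have th: "t \<in> homset C K X" unfolding t_def by (rule Comp_hom[OF tk n(2)])
  have "s \<oplus> t = Zero C K X"
    using fk Comp_Add_left[OF kh mp np] Comp_assoc[OF kh h(3) m(2)] Comp_assoc[OF kh h(4) n(2)]
    by (simp add: f_def s_def t_def)
  then have "s = Neg t" and "t = Neg s"
    using Neg_unique[OF oK o(3)] Add_comm[OF oK o(3)] sh th by simp_all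
  have s': "s = n \<cdot> Neg (pT \<cdot> k)"
    using \<open>s = Neg t\<close> Comp_Neg[OF n(2) tk] by (simp add: t_def)
  have t': "t = m \<cdot> Neg (pS \<cdot> k)"
    using \<open>t = Neg s\<close> Comp_Neg[OF m(2) sk] by (simp add: s_def)
  note Ns = Neg_hom[OF oK o(1) sk] and Nt = Neg_hom[OF oK o(2) tk]
  show inj: "injective C (m \<cdot> (pS \<cdot> k))" unfolding s_def[symmetric]
  proof (rule injectiveI[OF sh])
    fix W x y assume x: "x \<in> homset C W K" and y: "y \<in> homset C W K" and xy: "s \<cdot> x = s \<cdot> y"
    have "m \<cdot> ((pS \<cdot> k) \<cdot> x) = m \<cdot> ((pS \<cdot> k) \<cdot> y)"
      using xy Comp_assoc[OF x sk m(2)] Comp_assoc[OF y sk m(2)] by (simp add: s_def)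
    then have a: "(pS \<cdot> k) \<cdot> x = (pS \<cdot> k) \<cdot> y"
      using injectiveD[OF m Comp_hom[OF x sk] Comp_hom[OF y sk]] by simp
    have "n \<cdot> (Neg (pT \<cdot> k) \<cdot> x) = n \<cdot> (Neg (pT \<cdot> k) \<cdot> y)"
      using xy Comp_assoc[OF x Nt n(2)] Comp_assoc[OF y Nt n(2)] by (simp add: s')
    then have b': "Neg (pT \<cdot> k) \<cdot> x = Neg (pT \<cdot> k) \<cdot> y"
      using injectiveD[OF n Comp_hom[OF x Nt] Comp_hom[OF y Nt]] by simp
    have neg: "((pT \<cdot> k) \<cdot> z) \<oplus> (Neg (pT \<cdot> k) \<cdot> z) = Zero C W T" if z: "z \<in> homset C W K" for z
      using Comp_Add_left[OF z tk Nt] Add_Neg[OF oK o(2) tk] Zero_Comp[OF z o(2)] by simp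
    have oW: "W \<in> Obj C" using homD[OF x] by simp
    have b: "(pT \<cdot> k) \<cdot> x = (pT \<cdot> k) \<cdot> y"
      using neg[OF x] neg[OF y] b'
        Add_right_cancel[OF oW o(2) Comp_hom[OF x tk] Comp_hom[OF y tk] Comp_hom[OF x Nt]] by simp
    have dec: "k \<cdot> z = (iS \<cdot> ((pS \<cdot> k) \<cdot> z)) \<oplus> (iT \<cdot> ((pT \<cdot> k) \<cdot> z))" if z: "z \<in> homset C W K" for z
    proof -
      note kz = Comp_hom[OF z kh]
      have "k \<cdot> z = ((iS \<cdot> pS) \<oplus> (iT \<cdot> pT)) \<cdot> (k \<cdot> z)" using e(5) Ident_left[OF kz] by simp
      also have "\<dots> = ((iS \<cdot> pS) \<cdot> (k \<cdot> z)) \<oplus> ((iT \<cdot> pT) \<cdot> (k \<cdot> z))"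
        by (rule Comp_Add_left[OF kz Comp_hom[OF h(3,1)] Comp_hom[OF h(4,2)]])
      finally show ?thesis
        using Comp_assoc[OF kz h(3,1)] Comp_assoc[OF kz h(4,2)]
          Comp_assoc[OF z kh h(3)] Comp_assoc[OF z kh h(4)] by simp
    qed
    have "k \<cdot> x = k \<cdot> y" using dec[OF x] dec[OF y] a b by simp
    then show "x = y" using injectiveD[OF kernel_injective[OF k] kh x y] by simp
  qed
  have Dm: "Dom C m = S" "Cod C m = X" and Dn: "Dom C n = T" "Cod C n = X"
    and Ds: "Dom C s = K" "Cod C s = X"
    using homD[OF m(2)] homD[OF n(2)] homD[OF sh] by simp_all
  have inj': "injective C s" using inj by (simp add: s_def)
  have "sub_le C (subobj C s) (subobj C m)"
    using sub_le_subobj[OF inj' m(1)] sk Dm Ds s_def by auto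
  moreover have "sub_le C (subobj C s) (subobj C n)"
    using sub_le_subobj[OF inj' n(1)] Nt Dn Ds s' by auto
  moreover have "sub_le C V (subobj C s)"
    if V: "V \<in> Subobj C X" and l: "sub_le C V (subobj C m)" "sub_le C V (subobj C n)" for V
  proof -
    obtain v where v: "injective C v" "Cod C v = X" "V = subobj C v" using V by (rule SubobjE)
    define W where "W = Dom C v"
    obtain a where a: "a \<in> homset C W S" "v = m \<cdot> a"
      using l(1) v(3) sub_le_subobj[OF v(1) m(1)] Dm by (auto simp: W_def)
    obtain b where b: "b \<in> homset C W T" "v = n \<cdot> b"
      using l(2) v(3) sub_le_subobj[OF v(1) n(1)] Dn by (auto simp: W_def)
    have oW: "W \<in> Obj C" using homD[OF a(1)] by simp
    have vh: "v \<in> homset C W X" using injective_hom[OF v(1)] v(2) by (simp add: W_def)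
    note Nb = Neg_hom[OF oW o(2) b(1)]
    note ia = Comp_hom[OF a(1) h(1)] and ib = Comp_hom[OF Nb h(2)]
    define g where "g = (iS \<cdot> a) \<oplus> (iT \<cdot> Neg b)"
    have g: "g \<in> homset C W U" unfolding g_def by (rule Add_hom[OF oW o(4) ia ib])
    have pSg: "pS \<cdot> g = a"
      using Comp_Add_right[OF ia ib h(3)] Comp_assoc[OF a(1) h(1,3)] Comp_assoc[OF Nb h(2,3)]
        e(1,3) Ident_left[OF a(1)] Zero_Comp[OF Nb o(1)] Add_Zero[OF oW o(1) a(1)]
      by (simp add: g_def)
    have pTg: "pT \<cdot> g = Neg b"
      using Comp_Add_right[OF ia ib h(4)] Comp_assoc[OF a(1) h(1,4)] Comp_assoc[OF Nb h(2,4)]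
        e(2,4) Ident_left[OF Nb] Zero_Comp[OF a(1) o(2)] Zero_Add[OF oW o(2) Nb]
      by (simp add: g_def)
    have "f \<cdot> g = v \<oplus> Neg v"
      using Comp_Add_left[OF g mp np] Comp_assoc[OF g h(3) m(2)] Comp_assoc[OF g h(4) n(2)]
        pSg pTg Comp_Neg[OF n(2) b(1)] a(2) b(2) by (simp add: f_def)
    then have "f \<cdot> g = Zero C W X" using Add_Neg[OF oW o(3) vh] by simp
    then obtain u where u: "u \<in> homset C W K" "k \<cdot> u = g"
      using kernel_factor[OF k, of g W] g homD[OF f] by (auto simp: f_def K_def)
    have "v = s \<cdot> u"
      using Comp_assoc[OF u(1) sk m(2)] Comp_assoc[OF u(1) kh h(3)] u(2) pSg a(2)
      by (simp add: s_def)
    then show ?thesis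
      using sub_le_subobj[OF v(1) inj'] u(1) v(3) Ds by (auto simp: W_def)
  qed
  ultimately show "is_sub_meet C X (subobj C m) (subobj C n) (subobj C (m \<cdot> (pS \<cdot> k)))"
    using subobj_in_Subobj[OF inj'] Ds unfolding is_sub_meet_def s_def by blast
  then show "sub_inter C X (subobj C m) (subobj C n) = subobj C (m \<cdot> (pS \<cdot> k))"
    by (rule sub_inter_eqI)
qed

end

context abelian_category
begin

lemma sub_plus_eq:
  assumes m: "injective C m" "m \<in> homset C S X" and n: "injective C n" "n \<in> homset C T X"
    and U: "is_biproduct C S T U iS iT pS pT"
    and j: "is_image C j ((m \<cdot> pS) \<oplus> (n \<cdot> pT))"
  shows "is_sub_join C X (subobj C m) (subobj C n) (subobj C j)"
    and "sub_plus C X (subobj C m) (subobj C n) = subobj C j"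
proof -
  define f where "f = (m \<cdot> pS) \<oplus> (n \<cdot> pT)"
  have h: "iS \<in> homset C S U" "iT \<in> homset C T U" "pS \<in> homset C U S" "pT \<in> homset C U T"
    and e: "pS \<cdot> iS = Ident C S" "pT \<cdot> iT = Ident C T"
      "pS \<cdot> iT = Zero C T S" "pT \<cdot> iS = Zero C S T"
    using U by (simp_all add: is_biproduct_def)
  have o: "S \<in> Obj C" "T \<in> Obj C" "X \<in> Obj C" "U \<in> Obj C"
    using homD[OF m(2)] homD[OF n(2)] homD[OF h(1)] by simp_all
  note mp = Comp_hom[OF h(3) m(2)] and np = Comp_hom[OF h(4) n(2)]
  have f: "f \<in> homset C U X" unfolding f_def by (rule Add_hom[OF o(4,3) mp np])
  have fS: "f \<cdot> iS = m"
    using Comp_Add_left[OF h(1) mp np] Comp_assoc[OF h(1,3) m(2)] Comp_assoc[OF h(1,4) n(2)]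
      e(1,4) Ident_right[OF m(2)] Comp_Zero[OF n(2) o(1)] Add_Zero[OF o(1,3) m(2)]
    by (simp add: f_def)
  have fT: "f \<cdot> iT = n"
    using Comp_Add_left[OF h(2) mp np] Comp_assoc[OF h(2,3) m(2)] Comp_assoc[OF h(2,4) n(2)]
      e(2,3) Ident_right[OF n(2)] Comp_Zero[OF m(2) o(2)] Zero_Add[OF o(2,3) n(2)]
    by (simp add: f_def)
  obtain c where c: "is_cokernel C c f" "is_kernel C j c"
    using j by (auto simp: is_image_def f_def)
  define Q where "Q = Cod C c"
  have ch: "c \<in> homset C X Q" and cf: "c \<cdot> f = Zero C U Q"
    using c(1) homD[OF f] by (auto simp: is_cokernel_def Q_def)
  define J where "J = Dom C j"
  have jh: "j \<in> homset C J X" using kernel_hom[OF c(2)] homD[OF ch] by (simp add: J_def)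
  have cj: "c \<cdot> j = Zero C J Q" using c(2) by (simp add: is_kernel_def J_def Q_def)
  obtain l where l: "l \<in> homset C U J" "j \<cdot> l = f"
    using kernel_factor[OF c(2), of f U] f cf homD[OF ch] by (auto simp: J_def)
  note inj = kernel_injective[OF c(2)]
  have D: "Dom C m = S" "Cod C m = X" "Dom C n = T" "Cod C n = X" "Dom C j = J" "Cod C j = X"
    using homD[OF m(2)] homD[OF n(2)] homD[OF jh] by simp_all
  have "m = j \<cdot> (l \<cdot> iS)" using Comp_assoc[OF h(1) l(1) jh] l(2) fS by simp
  then have "sub_le C (subobj C m) (subobj C j)"
    using sub_le_subobj[OF m(1) inj] Comp_hom[OF h(1) l(1)] D by auto
  moreover have "n = j \<cdot> (l \<cdot> iT)" using Comp_assoc[OF h(2) l(1) jh] l(2) fT by simp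
  then have "sub_le C (subobj C n) (subobj C j)"
    using sub_le_subobj[OF n(1) inj] Comp_hom[OF h(2) l(1)] D by auto
  moreover have "sub_le C (subobj C j) V"
    if V: "V \<in> Subobj C X" and le: "sub_le C (subobj C m) V" "sub_le C (subobj C n) V" for V
  proof -
    obtain v where v: "injective C v" "Cod C v = X" "V = subobj C v" using V by (rule SubobjE)
    define W where "W = Dom C v"
    have vh: "v \<in> homset C W X" using injective_hom[OF v(1)] v(2) by (simp add: W_def)
    obtain a where a: "a \<in> homset C S W" "m = v \<cdot> a"
      using le(1) v(3) sub_le_subobj[OF m(1) v(1)] D by (auto simp: W_def)
    obtain b where b: "b \<in> homset C T W" "n = v \<cdot> b"
      using le(2) v(3) sub_le_subobj[OF n(1) v(1)] D by (auto simp: W_def)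
    obtain q where q: "is_kernel C v q" using injective_normal[OF v(1)] by blast
    define R where "R = Cod C q"
    have qX: "Dom C q = X" using homD[OF kernel_hom[OF q]] v(2) by simp
    have qh: "q \<in> homset C X R" using q homI[of q] qX by (simp add: is_kernel_def R_def)
    have oR: "R \<in> Obj C" using homD[OF qh] by simp
    have qv: "q \<cdot> v = Zero C W R" using q by (simp add: is_kernel_def W_def R_def)
    have f': "f = v \<cdot> ((a \<cdot> pS) \<oplus> (b \<cdot> pT))"
      using Comp_Add_right[OF Comp_hom[OF h(3) a(1)] Comp_hom[OF h(4) b(1)] vh]
        Comp_assoc[OF h(3) a(1) vh] Comp_assoc[OF h(4) b(1) vh] a(2) b(2) by (simp add: f_def)
    have oW: "W \<in> Obj C" using homD[OF vh] by simp
    have ab: "(a \<cdot> pS) \<oplus> (b \<cdot> pT) \<in> homset C U W"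
      by (rule Add_hom[OF o(4) oW Comp_hom[OF h(3) a(1)] Comp_hom[OF h(4) b(1)]])
    have "q \<cdot> f = Zero C U R"
      using Comp_assoc[OF ab vh qh] f' qv Zero_Comp[OF ab oR] by simp
    then obtain w where w: "w \<in> homset C Q R" "w \<cdot> c = q"
      using c(1) qh oR homD[OF f] unfolding is_cokernel_def Q_def by blast
    have "q \<cdot> j = Zero C J R"
      using Comp_assoc[OF jh ch w(1)] w(2) cj Comp_Zero[OF w(1)] homD[OF jh] by simp
    then obtain u where "u \<in> homset C J W" "v \<cdot> u = j"
      using kernel_factor[OF q, of j J] jh qX by (auto simp: W_def R_def)
    then show ?thesis using sub_le_subobj[OF inj v(1)] v(3) D by (auto simp: W_def)
  qed
  ultimately show "is_sub_join C X (subobj C m) (subobj C n) (subobj C j)"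
    using subobj_in_Subobj[OF inj] D unfolding is_sub_join_def by auto
  then show "sub_plus C X (subobj C m) (subobj C n) = subobj C j"
    by (rule sub_plus_eqI)
qed

end

end

theory Submission
  imports Defs
begin

text \<open>
  The values at \<open>\<emptyset>\<close> and \<open>I\<close> come from \<open>\<sigma>(\<emptyset>) = 0\<close> and \<open>\<iota>(I,I) = id\<close>.  Condition (B)
  makes \<open>J \<mapsto> S\<^sup>J\<close> monotone, so \<open>S\<^bsup>A \<inter> B\<^esup>\<close> is a lower bound and \<open>S\<^bsup>A \<union> B\<^esup>\<close> an upper
  bound of \<open>S\<^sup>A\<close> and \<open>S\<^sup>B\<close>.  What remains are the two universal properties, and each is a short
  diagram chase around one square of type (D).  Condition (A) enters through the fact that in a
  short exact sequence the left map is a kernel of the right one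
  (\<open>exact_injective_factor\<close>) and the right map a cokernel of the left one
  (\<open>exact_surjective_factor\<close>).

  Intersection (\<open>factor_through_Int\<close>): let \<open>v\<close> factor through \<open>\<iota>(A,I)\<close>, as \<open>\<iota>(A,I) \<circ> a\<close>, and
  through \<open>\<iota>(B,I)\<close>. Then \<open>\<pi>(I,I - B) \<circ> v = 0\<close>, and by (D) this composite equals
  \<open>\<iota>(A - B,I - B) \<circ> \<pi>(A,A - B) \<circ> a\<close>. As \<open>\<iota>(A - B,I - B)\<close> is injective, \<open>\<pi>(A,A - B) \<circ> a = 0\<close>, so \<open>a\<close>
  factors through the kernel \<open>\<iota>(A \<inter> B,A)\<close> of \<open>\<pi>(A,A - B)\<close>.

  Sum (\<open>vanish_on_Un\<close>): a subobject is the kernel of some \<open>q\<close>, so containing another subobject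
  means that \<open>q\<close> vanishes on it.  If \<open>p\<close>, defined on \<open>\<sigma>(A \<union> B)\<close>, vanishes on \<open>\<sigma>(A)\<close>, then
  \<open>p = u \<circ> \<pi>(A \<union> B,B - A)\<close>.  By (D), \<open>\<pi>(A \<union> B,B - A) \<circ> \<iota>(B,A \<union> B) = \<pi>(B,B - A)\<close>; so if \<open>p\<close> also
  vanishes on \<open>\<sigma>(B)\<close>, then \<open>u \<circ> \<pi>(B,B - A) = 0\<close>, whence \<open>u = 0\<close> and \<open>p = 0\<close>.
\<close>

section \<open>Exactness in abelian categories\<close>

context category
begin

lemma surjectiveD:
  assumes "surjective C e" "e \<in> homset C X Y" "f \<in> homset C Y W" "g \<in> homset C Y W" "f \<cdot> e = g \<cdot> e"
  shows "f = g"
  using assms homD[OF assms(2)] homD[OF assms(3)] unfolding surjective_def by blast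

lemma injective_from_zero_object:
  assumes "zero_object C Z" "m \<in> homset C Z X"
  shows "injective C m"
proof (rule injectiveI[OF assms(2)])
  fix W f g assume f: "f \<in> homset C W Z" and g: "g \<in> homset C W Z"
  have "\<exists>!h. h \<in> homset C W Z" using assms(1) homD[OF f] by (simp add: zero_object_def)
  then show "f = g" using f g by blast
qed

lemma subobj_from_zero_object_unique:
  assumes Z: "zero_object C Z" "m \<in> homset C Z X" and Z': "zero_object C Z'" "n \<in> homset C Z' X"
  shows "subobj C m = subobj C n"
proof -
  have le: "sub_le C (subobj C f) (subobj C g)"
    if Y: "zero_object C Y" "f \<in> homset C Y X" and Y': "zero_object C Y'" "g \<in> homset C Y' X"
    for Y Y' f g
  proof -
    have unique: "\<exists>!h. h \<in> homset C Y V" if "V \<in> Obj C" for V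
      using Y(1) that by (simp add: zero_object_def)
    have "Y' \<in> Obj C" using homD[OF Y'(2)] by blast
    then obtain a where a: "a \<in> homset C Y Y'" using unique[of Y'] by blast
    have "f = g \<cdot> a" using unique homD[OF Y(2)] Y(2) Comp_hom[OF a Y'(2)] by blast
    then show ?thesis
      using sub_le_subobj[OF injective_from_zero_object[OF Y] injective_from_zero_object[OF Y']]
        a homD[OF Y(2)] homD[OF Y'(2)] by auto
  qed
  have "subobj C m \<in> Subobj C X" "subobj C n \<in> Subobj C X"
    using subobj_in_Subobj injective_from_zero_object[OF Z] injective_from_zero_object[OF Z']
      homD[OF Z(2)] homD[OF Z'(2)] by metis+
  then show ?thesis using sub_le_antisym le[OF Z Z'] le[OF Z' Z] by blast
qed

end

context preadditive_category
begin

lemma cokernel_factor: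
  assumes "is_cokernel C c f" "h \<in> homset C (Cod C f) W" "h \<cdot> f = Zero C (Dom C f) W"
  shows "\<exists>u \<in> homset C (Cod C c) W. u \<cdot> c = h"
  using assms homD[OF assms(2)] unfolding is_cokernel_def by blast

text \<open>Exactness at \<open>Y\<close> supplies a single \<open>e\<close> that is both a kernel of a cokernel \<open>c\<close> of \<open>f\<close>
  and a kernel of \<open>g\<close>. Hence \<open>g\<close> and \<open>c\<close> annihilate the same morphisms.\<close>

lemma exact_atE:
  assumes ex: "exact_at C f g" and f: "f \<in> homset C X Y" and g: "g \<in> homset C Y Z"
  obtains c Q where "is_cokernel C c f" "c \<in> homset C Y Q"
    "\<And>W h. h \<in> homset C W Y \<Longrightarrow> g \<cdot> h = Zero C W Z \<longleftrightarrow> c \<cdot> h = Zero C W Q"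
proof -
  obtain e c where c: "is_cokernel C c f" and ec: "is_kernel C e c" and eg: "is_kernel C e g"
    using ex unfolding exact_at_def is_image_def by blast
  have ch: "c \<in> homset C Y (Cod C c)" using c homD[OF f] by (simp add: is_cokernel_def)
  define E where "E = Dom C e"
  have eh: "e \<in> homset C E Y" using kernel_hom[OF eg] homD[OF g] by (simp add: E_def)
  have transfer: "l \<cdot> h = Zero C W V"
    if k: "is_kernel C e k" "k \<in> homset C Y U" and l: "is_kernel C e l" "l \<in> homset C Y V"
      and h: "h \<in> homset C W Y" "k \<cdot> h = Zero C W U" for k l h U V W
  proof -
    obtain w where w: "w \<in> homset C W E" "e \<cdot> w = h"
      using kernel_factor[OF k(1), of h W] h homD[OF k(2)] by (auto simp: E_def)
    have "l \<cdot> e = Zero C E V" using l(1) homD[OF l(2)] by (simp add: is_kernel_def E_def)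
    then show ?thesis
      using Comp_assoc[OF w(1) eh l(2)] w(2) Zero_Comp[OF w(1)] homD[OF l(2)] by simp
  qed
  show ?thesis
    using that[OF c ch] transfer[OF eg g ec ch] transfer[OF ec ch eg g] by blast
qed

lemma exact_at_comp_zero:
  assumes ex: "exact_at C f g" and f: "f \<in> homset C X Y" and g: "g \<in> homset C Y Z"
  shows "g \<cdot> f = Zero C X Z"
proof -
  obtain c Q where c: "is_cokernel C c f" "c \<in> homset C Y Q"
    and same: "\<And>W h. h \<in> homset C W Y \<Longrightarrow> g \<cdot> h = Zero C W Z \<longleftrightarrow> c \<cdot> h = Zero C W Q"
    using exact_atE[OF assms] by metis
  have "c \<cdot> f = Zero C X Q" using c homD[OF f] homD[OF c(2)] by (simp add: is_cokernel_def)
  then show ?thesis using same[OF f] by simp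
qed

end

context abelian_category
begin

text \<open>Exactness only says that the image of \<open>f\<close> is the kernel of \<open>g\<close>; that an injective \<open>f\<close> is its
  own image comes from normality: \<open>f\<close> is the kernel of some \<open>q\<close>, and \<open>q\<close> factors through a cokernel
  of \<open>f\<close>, hence vanishes wherever \<open>g\<close> does.\<close>

lemma exact_injective_factor:
  assumes ex: "exact_at C f g" and f: "f \<in> homset C X Y" and g: "g \<in> homset C Y Z"
    and inj: "injective C f" and h: "h \<in> homset C W Y" and gh: "g \<cdot> h = Zero C W Z"
  shows "\<exists>u \<in> homset C W X. h = f \<cdot> u"
proof -
  obtain c Q where c: "is_cokernel C c f" "c \<in> homset C Y Q"
    and same: "\<And>W h. h \<in> homset C W Y \<Longrightarrow> g \<cdot> h = Zero C W Z \<longleftrightarrow> c \<cdot> h = Zero C W Q"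
    using exact_atE[OF ex f g] by metis
  obtain q where q: "is_kernel C f q" using injective_normal[OF inj] by blast
  define R where "R = Cod C q"
  have qh: "q \<in> homset C Y R" and qf: "q \<cdot> f = Zero C X R"
    using q homI[of q] homD[OF f] by (auto simp: is_kernel_def R_def homset_def)
  have oR: "R \<in> Obj C" using homD[OF qh] by simp
  obtain q' where q': "q' \<in> homset C Q R" "q' \<cdot> c = q"
    using cokernel_factor[OF c(1), of q R] qh qf homD[OF f] homD[OF c(2)] by auto
  have "c \<cdot> h = Zero C W Q" using same[OF h] gh by simp
  then have "q \<cdot> h = Zero C W R"
    using Comp_assoc[OF h c(2) q'(1)] q'(2) Comp_Zero[OF q'(1)] homD[OF h] by simp
  then show ?thesis
    using kernel_factor[OF q, of h W] h homD[OF qh] homD[OF f] by force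
qed

text \<open>Dually, a surjective \<open>g\<close> is the cokernel of some \<open>k\<close>.  As \<open>g \<circ> k = 0\<close>, a cokernel of \<open>f\<close>
  annihilates \<open>k\<close>, and so does every \<open>p\<close> that vanishes on \<open>f\<close>.\<close>

lemma exact_surjective_factor:
  assumes ex: "exact_at C f g" and f: "f \<in> homset C X Y" and g: "g \<in> homset C Y Z"
    and surj: "surjective C g" and p: "p \<in> homset C Y W" and pf: "p \<cdot> f = Zero C X W"
  shows "\<exists>u \<in> homset C Z W. p = u \<cdot> g"
proof -
  obtain c Q where c: "is_cokernel C c f" "c \<in> homset C Y Q"
    and same: "\<And>W h. h \<in> homset C W Y \<Longrightarrow> g \<cdot> h = Zero C W Z \<longleftrightarrow> c \<cdot> h = Zero C W Q"
    using exact_atE[OF ex f g] by metis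
  obtain k where k: "is_cokernel C g k" using surjective_conormal[OF surj] by blast
  define V where "V = Dom C k"
  have kh: "k \<in> homset C V Y" and gk: "g \<cdot> k = Zero C V Z"
    using k homD[OF g] by (auto simp: is_cokernel_def V_def homset_def)
  obtain p' where p': "p' \<in> homset C Q W" "p' \<cdot> c = p"
    using cokernel_factor[OF c(1), of p W] p pf homD[OF f] homD[OF c(2)] by auto
  have "c \<cdot> k = Zero C V Q" using same[OF kh] gk by simp
  then have "p \<cdot> k = Zero C V W"
    using Comp_assoc[OF kh c(2) p'(1)] p'(2) Comp_Zero[OF p'(1)] homD[OF kh] by simp
  then show ?thesis
    using cokernel_factor[OF k, of p W] p homD[OF kh] homD[OF g] by force
qed

end

section \<open>Differences of s-sets\<close>

lemma s_set_empty: "s_set I r {}" and s_set_carrier: "s_set I r I"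
  and s_set_Int: "s_set I r A \<Longrightarrow> s_set I r B \<Longrightarrow> s_set I r (A \<inter> B)"
  and s_set_Un: "s_set I r A \<Longrightarrow> s_set I r B \<Longrightarrow> s_set I r (A \<union> B)"
  by (auto simp: s_set_def)

lemma Diff_f_sets: "s_set I r A \<Longrightarrow> s_set I r B \<Longrightarrow> A - B \<in> f_sets I r"
  unfolding s_set_def f_sets_def by blast

lemma s_set_f_sets: "s_set I r A \<Longrightarrow> A \<in> f_sets I r"
  using Diff_f_sets[OF _ s_set_empty] by fastforce

lemma Diff_G_pairs:
  assumes "s_set I r A" "s_set I r K" "s_set I r B" "A \<subseteq> K"
  shows "(A - B, K - B) \<in> G_pairs I r"
  using Diff_f_sets[OF assms(1,3)] Diff_f_sets[OF assms(2,3)] assms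
  unfolding G_pairs_def s_set_def by blast

lemma s_set_G_pairs: "s_set I r A \<Longrightarrow> s_set I r K \<Longrightarrow> A \<subseteq> K \<Longrightarrow> (A, K) \<in> G_pairs I r"
  using Diff_G_pairs[OF _ _ s_set_empty] by fastforce

lemma Diff_H_pairs:
  assumes "s_set I r K" "s_set I r B"
  shows "(K, K - B) \<in> H_pairs I r"
  using s_set_f_sets[OF assms(1)] Diff_f_sets[OF assms] assms
  unfolding H_pairs_def s_set_def by blast

section \<open>The subobjects of a configuration\<close>

locale abelian_configuration = abelian_category C + configuration C I r \<sigma> \<iota> \<pi>
  for C (structure) and I r \<sigma> \<iota> \<pi>
begin

lemma iota_s_set:
  assumes "s_set I r A" "s_set I r K" "A \<subseteq> K"
  shows "\<iota> A K \<in> homset C (\<sigma> A) (\<sigma> K)" "injective C (\<iota> A K)"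
  using iota_hom iota_injective s_set_G_pairs[OF assms] by auto

lemma pi_s_set:
  assumes "s_set I r K" "s_set I r B"
  shows "\<pi> K (K - B) \<in> homset C (\<sigma> K) (\<sigma> (K - B))" "surjective C (\<pi> K (K - B))"
  using pi_hom pi_surjective Diff_H_pairs[OF assms] by auto

lemma exact_s_set:
  assumes "s_set I r A" "s_set I r K" "A \<subseteq> K"
  shows "exact_at C (\<iota> A K) (\<pi> K (K - A))"
  using config_A[OF s_set_G_pairs[OF assms]] unfolding short_exact_def by blast

text \<open>The square (D) used here has corners \<open>\<sigma>(A)\<close>, \<open>\<sigma>(I)\<close>, \<open>\<sigma>(A - B)\<close>, \<open>\<sigma>(I - B)\<close>; it turns
  vanishing in \<open>\<sigma>(I - B)\<close> into vanishing in \<open>\<sigma>(A - B)\<close>, since \<open>\<iota>(A - B,I - B)\<close> is injective.\<close>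

lemma factor_through_Int:
  assumes A: "s_set I r A" and B: "s_set I r B"
    and a: "a \<in> homset C W (\<sigma> A)" and b: "b \<in> homset C W (\<sigma> B)" and ab: "\<iota> A I \<cdot> a = \<iota> B I \<cdot> b"
  shows "\<exists>u \<in> homset C W (\<sigma> (A \<inter> B)). \<iota> A I \<cdot> a = \<iota> (A \<inter> B) I \<cdot> u"
proof -
  note AB = s_set_Int[OF A B] and carrier = s_set_carrier[of I r]
  have sub: "A \<subseteq> I" "B \<subseteq> I" using A B by (auto simp: s_set_def)
  note iA = iota_s_set(1)[OF A carrier sub(1)] and iB = iota_s_set(1)[OF B carrier sub(2)]
  note pI = pi_s_set(1)[OF carrier B] and pA = pi_s_set(1)[OF A B]
  note GD = Diff_G_pairs[OF A carrier B sub(1)]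
  have oW: "W \<in> Obj C" using homD[OF a] by simp
  have "A \<inter> (I - B) = A - B" using sub by blast
  then have D: "\<pi> I (I - B) \<cdot> \<iota> A I = \<iota> (A - B) (I - B) \<cdot> \<pi> A (A - B)"
    using config_D[OF s_set_G_pairs[OF A carrier sub(1)] Diff_H_pairs[OF carrier B]] by simp
  have "\<iota> (A - B) (I - B) \<cdot> (\<pi> A (A - B) \<cdot> a) = \<pi> I (I - B) \<cdot> (\<iota> B I \<cdot> b)"
    using Comp_assoc[OF a pA iota_hom[OF GD]] Comp_assoc[OF a iA pI] D ab by simp
  also have "\<dots> = Zero C W (\<sigma> (I - B))"
    using Comp_assoc[OF b iB pI] exact_at_comp_zero[OF exact_s_set[OF B carrier sub(2)] iB pI]
      Zero_Comp[OF b] homD[OF pI] by simp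
  also have "\<dots> = \<iota> (A - B) (I - B) \<cdot> Zero C W (\<sigma> (A - B))"
    using Comp_Zero[OF iota_hom[OF GD] oW] by simp
  finally have "\<pi> A (A - B) \<cdot> a = Zero C W (\<sigma> (A - B))"
    using injectiveD[OF iota_injective[OF GD] iota_hom[OF GD] Comp_hom[OF a pA]]
      Zero_hom[OF oW] homD[OF pA] by blast
  moreover have "exact_at C (\<iota> (A \<inter> B) A) (\<pi> A (A - B))"
    using exact_s_set[OF AB A] by (simp add: Diff_Int)
  ultimately obtain u where u: "u \<in> homset C W (\<sigma> (A \<inter> B))" "a = \<iota> (A \<inter> B) A \<cdot> u"
    using exact_injective_factor[OF _ iota_s_set(1)[OF AB A] pA iota_s_set(2)[OF AB A] a] by auto
  have "\<iota> A I \<cdot> a = \<iota> (A \<inter> B) I \<cdot> u"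
    using u(2) Comp_assoc[OF u(1) iota_s_set(1)[OF AB A] iA]
      config_B[OF s_set_G_pairs[OF AB A] s_set_G_pairs[OF A carrier sub(1)]] by simp
  then show ?thesis using u(1) by blast
qed

text \<open>That \<open>\<sigma>(A)\<close> and \<open>\<sigma>(B)\<close> jointly span \<open>\<sigma>(A \<union> B)\<close>: the quotient of \<open>\<sigma>(A \<union> B)\<close> by
  \<open>\<sigma>(A)\<close> is \<open>\<sigma>(B - A)\<close>, and by (D) the composite of \<open>\<iota>(B,A \<union> B)\<close> with the projection onto this
  quotient is the surjection \<open>\<pi>(B,B - A)\<close>.\<close>

lemma vanish_on_Un:
  assumes A: "s_set I r A" and B: "s_set I r B" and p: "p \<in> homset C (\<sigma> (A \<union> B)) W"
    and pA: "p \<cdot> \<iota> A (A \<union> B) = Zero C (\<sigma> A) W" and pB: "p \<cdot> \<iota> B (A \<union> B) = Zero C (\<sigma> B) W"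
  shows "p = Zero C (\<sigma> (A \<union> B)) W"
proof -
  note AB = s_set_Un[OF A B]
  have oW: "W \<in> Obj C" using homD[OF p] by simp
  have dif: "(A \<union> B) - A = B - A" "B \<inter> (B - A) = B - A" by blast+
  note iA = iota_s_set[OF A AB Un_upper1] and iB = iota_s_set(1)[OF B AB Un_upper2]
  note pU = pi_s_set[OF AB A, unfolded dif] and pD = pi_s_set[OF B A]
  obtain u where u: "u \<in> homset C (\<sigma> (B - A)) W" "p = u \<cdot> \<pi> (A \<union> B) (B - A)"
    using exact_surjective_factor[OF exact_s_set[OF A AB Un_upper1, unfolded dif] iA(1) pU p pA]
    by blast
  have "\<pi> (A \<union> B) (B - A) \<cdot> \<iota> B (A \<union> B) = \<iota> (B - A) (B - A) \<cdot> \<pi> B (B - A)"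
    using config_D[OF s_set_G_pairs[OF B AB Un_upper2] Diff_H_pairs[OF AB A]] dif by simp
  also have "\<dots> = \<pi> B (B - A)"
    using iota_refl[OF Diff_f_sets[OF B A]] Ident_left[OF pD(1)] by simp
  finally have "u \<cdot> \<pi> B (B - A) = Zero C (\<sigma> B) W"
    using Comp_assoc[OF iB pU(1) u(1)] u(2) pB by simp
  also have "\<dots> = Zero C (\<sigma> (B - A)) W \<cdot> \<pi> B (B - A)"
    using Zero_Comp[OF pD(1) oW] by simp
  finally have "u = Zero C (\<sigma> (B - A)) W"
    using surjectiveD[OF pD(2,1) u(1)] Zero_hom[OF _ oW] homD[OF pD(1)] by blast
  then show ?thesis using u(2) Zero_Comp[OF pU(1) oW] by simp
qed

abbreviation sub where
  "sub J \<equiv> subobj C (\<iota> J I)"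

lemma iota_carrier:
  assumes "s_set I r A"
  shows "\<iota> A I \<in> homset C (\<sigma> A) (\<sigma> I)" "injective C (\<iota> A I)"
    "Dom C (\<iota> A I) = \<sigma> A" "Cod C (\<iota> A I) = \<sigma> I"
proof -
  have "A \<subseteq> I" using assms by (simp add: s_set_def)
  note i = iota_s_set[OF assms s_set_carrier this]
  show "\<iota> A I \<in> homset C (\<sigma> A) (\<sigma> I)" "injective C (\<iota> A I)"
    "Dom C (\<iota> A I) = \<sigma> A" "Cod C (\<iota> A I) = \<sigma> I" using i homD[OF i(1)] by auto
qed

lemma sub_in_Subobj: "s_set I r A \<Longrightarrow> sub A \<in> Subobj C (\<sigma> I)"
  using subobj_in_Subobj[OF iota_carrier(2)] iota_carrier(4) by metis

lemma sub_mono: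
  assumes A: "s_set I r A" and B: "s_set I r B" and AB: "A \<subseteq> B"
  shows "sub_le C (sub A) (sub B)"
proof -
  have "B \<subseteq> I" using B by (simp add: s_set_def)
  then have "\<iota> A I = \<iota> B I \<cdot> \<iota> A B"
    using config_B[OF s_set_G_pairs[OF A B AB] s_set_G_pairs[OF B s_set_carrier]] by simp
  then show ?thesis
    using sub_le_subobj[OF iota_carrier(2)[OF A] iota_carrier(2)[OF B]] iota_s_set(1)[OF A B AB]
      iota_carrier(3)[OF A] iota_carrier(3)[OF B] by auto
qed

lemma sub_meet:
  assumes A: "s_set I r A" and B: "s_set I r B"
  shows "is_sub_meet C (\<sigma> I) (sub A) (sub B) (sub (A \<inter> B))"
proof -
  note AB = s_set_Int[OF A B]
  note D = iota_carrier(3)[OF A] iota_carrier(3)[OF B] iota_carrier(3)[OF AB]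
  have "sub_le C T (sub (A \<inter> B))"
    if T: "T \<in> Subobj C (\<sigma> I)" "sub_le C T (sub A)" "sub_le C T (sub B)" for T
  proof -
    obtain v where v: "injective C v" "T = subobj C v" using T(1) by (auto elim: SubobjE)
    obtain a where a: "a \<in> homset C (Dom C v) (\<sigma> A)" "v = \<iota> A I \<cdot> a"
      using T(2) v sub_le_subobj[OF v(1) iota_carrier(2)[OF A]] D by auto
    obtain b where b: "b \<in> homset C (Dom C v) (\<sigma> B)" "v = \<iota> B I \<cdot> b"
      using T(3) v sub_le_subobj[OF v(1) iota_carrier(2)[OF B]] D by auto
    have "\<exists>u \<in> homset C (Dom C v) (\<sigma> (A \<inter> B)). v = \<iota> (A \<inter> B) I \<cdot> u"
      using factor_through_Int[OF A B a(1) b(1)] a(2) b(2) by simp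
    then show ?thesis using sub_le_subobj[OF v(1) iota_carrier(2)[OF AB]] v(2) D by simp
  qed
  then show ?thesis
    using sub_in_Subobj[OF AB] sub_mono[OF AB A] sub_mono[OF AB B]
    unfolding is_sub_meet_def by blast
qed

lemma sub_join:
  assumes A: "s_set I r A" and B: "s_set I r B"
  shows "is_sub_join C (\<sigma> I) (sub A) (sub B) (sub (A \<union> B))"
proof -
  note AB = s_set_Un[OF A B] and carrier = s_set_carrier[of I r]
  note i = iota_carrier(1)[OF AB]
  have "sub_le C (sub (A \<union> B)) T"
    if T: "T \<in> Subobj C (\<sigma> I)" "sub_le C (sub A) T" "sub_le C (sub B) T" for T
  proof -
    obtain v where v: "injective C v" "Cod C v = \<sigma> I" "T = subobj C v"
      using T(1) by (rule SubobjE)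
    \<comment> \<open>An upper bound \<open>v\<close> is compared through the map \<open>q\<close> that it is the kernel of: a morphism
      factors through \<open>v\<close> as soon as \<open>q\<close> annihilates it.\<close>
    obtain q where q: "is_kernel C v q" using injective_normal[OF v(1)] by blast
    define R where "R = Cod C q"
    have qh: "q \<in> homset C (\<sigma> I) R" and qv: "q \<cdot> v = Zero C (Dom C v) R"
      using q v(2) by (auto simp: is_kernel_def R_def homset_def)
    have oR: "R \<in> Obj C" using homD[OF qh] by simp
    have vh: "v \<in> homset C (Dom C v) (\<sigma> I)" using injective_hom[OF v(1)] v(2) by simp
    have vanish: "(q \<cdot> \<iota> (A \<union> B) I) \<cdot> \<iota> D (A \<union> B) = Zero C (\<sigma> D) R"
      if D: "s_set I r D" "D \<subseteq> A \<union> B" "sub_le C (sub D) T" for D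
    proof -
      obtain a where a: "a \<in> homset C (\<sigma> D) (Dom C v)" "\<iota> D I = v \<cdot> a"
        using D(3) v(3) sub_le_subobj[OF iota_carrier(2)[OF D(1)] v(1)] iota_carrier(3)[OF D(1)]
        by auto
      have "A \<union> B \<subseteq> I" using AB by (simp add: s_set_def)
      then have "(q \<cdot> \<iota> (A \<union> B) I) \<cdot> \<iota> D (A \<union> B) = q \<cdot> \<iota> D I"
        using Comp_assoc[OF iota_s_set(1)[OF D(1) AB D(2)] i qh]
          config_B[OF s_set_G_pairs[OF D(1) AB D(2)] s_set_G_pairs[OF AB carrier]] by simp
      also have "\<dots> = Zero C (\<sigma> D) R"
        using a(2) Comp_assoc[OF a(1) vh qh] qv Zero_Comp[OF a(1) oR] by simp
      finally show ?thesis .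
    qed
    have "q \<cdot> \<iota> (A \<union> B) I = Zero C (\<sigma> (A \<union> B)) R"
      using vanish_on_Un[OF A B Comp_hom[OF i qh]] vanish[OF A _ T(2)] vanish[OF B _ T(3)] by simp
    then obtain u where "u \<in> homset C (\<sigma> (A \<union> B)) (Dom C v)" "\<iota> (A \<union> B) I = v \<cdot> u"
      using kernel_factor[OF q, of "\<iota> (A \<union> B) I"] i homD[OF qh] by force
    then show ?thesis
      using sub_le_subobj[OF iota_carrier(2)[OF AB] v(1)] v(3) iota_carrier(3)[OF AB] by metis
  qed
  then show ?thesis
    using sub_in_Subobj[OF AB] sub_mono[OF A AB] sub_mono[OF B AB]
    unfolding is_sub_join_def by blast
qed

text \<open>\<open>sub_zero\<close> is represented by the zero morphism from an arbitrarily chosen zero object, which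
  need not be \<open>\<sigma>(\<emptyset>)\<close>; the two classes agree nevertheless, as zero objects are isomorphic.\<close>

lemma sub_empty: "sub {} = sub_zero C (\<sigma> I)"
proof -
  have Z: "zero_object C (SOME Z. zero_object C Z)" by (rule someI_ex[OF ex_zero_object])
  have "\<sigma> I \<in> Obj C" using sigma_Obj[OF s_set_f_sets[OF s_set_carrier]] .
  then have "Zero C (SOME Z. zero_object C Z) (\<sigma> I) \<in> homset C (SOME Z. zero_object C Z) (\<sigma> I)"
    using Zero_hom Z by (simp add: zero_object_def)
  then show ?thesis
    unfolding sub_zero_def
    using subobj_from_zero_object_unique[OF sigma_empty iota_carrier(1)[OF s_set_empty] Z] by simp
qed

lemma sub_carrier: "sub I = sub_top C (\<sigma> I)"
  using iota_refl[OF s_set_f_sets[OF s_set_carrier]] by (simp add: sub_top_def)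

end

theorem theorem4p5:
  fixes C :: "('o, 'm, 'z) preadditive_data_scheme"
    and I :: "'i set" and r :: "'i rel"
    and \<sigma> :: "'i set \<Rightarrow> 'o"
    and \<iota> \<pi> :: "'i set \<Rightarrow> 'i set \<Rightarrow> 'm"
    and X :: 'o and S :: "'i set \<Rightarrow> 'm set"
  assumes "finite I" and "partial_order_on I r"
    and "abelian_category C"
    and "configuration C I r \<sigma> \<iota> \<pi>"
    and "X = \<sigma> I"
    and "\<forall>J. s_set I r J \<longrightarrow> S J = subobj C (\<iota> J I)"
  shows "S {} = sub_zero C X \<and> S I = sub_top C X \<and>
    (\<forall>A B. s_set I r A \<and> s_set I r B \<longrightarrow>
       sub_inter C X (S A) (S B) = S (A \<inter> B) \<and>
       sub_plus C X (S A) (S B) = S (A \<union> B))"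
proof -
  interpret abelian_configuration C I r \<sigma> \<iota> \<pi>
    using assms(3,4) by (rule abelian_configuration.intro)
  have S: "S J = sub J" if "s_set I r J" for J using assms(6) that by blast
  show ?thesis
    using sub_inter_eqI[OF sub_meet] sub_plus_eqI[OF sub_join] sub_empty sub_carrier
    by (auto simp: S assms(5) s_set_empty s_set_carrier s_set_Int s_set_Un)
qed

end
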